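(* There is an absolute constant $C$ such that for every integer $m\ge1$ and every $T\in\mathbb{Z}_2^m$, the function $f:(\mathbb{Z}_2^m)^3\to\{0,1\}$ given by $f(x,y,z)=1$ if and only if $x+y+z=T$ satisfies $$\chi_3(f)\le C\,m\,2^{m/2}.$$
   Context: In a product $X_1\times X_2\times X_3$ (here each factor is $\mathbb{Z}_2^m$), a cylinder in dimension $i$ is a subset closed under arbitrary changes of the $i$-th coordinate, and a cylinder intersection is a set $T_1\cap T_2\cap T_3$ with $T_i$ a cylinder in dimension $i$. $\chi_3(f)$ is the least number of cylinder intersections, each contained in $f^{-1}(1)$, whose union is $f^{-1}(1)$. *)

theory Defs
  imports Complex_Main "HOL-Library.Z2" "HOL-Library.Function_Algebras"
begin

text \<open>The group $\mathbb{Z}_2^m$, for a variable \<open>m\<close>: vectors over the two-element field \<open>bit\<close>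
  whose coordinates are \<open>0, \<dots>, m - 1\<close>, padded by zeros. Addition is the pointwise
  addition of functions.\<close>

definition Z2_pow :: "nat \<Rightarrow> (nat \<Rightarrow> bit) set" where
  "Z2_pow m = {x. \<forall>i\<ge>m. x i = 0}"

definition cylinder1 :: "'a set \<Rightarrow> 'b set \<Rightarrow> 'c set \<Rightarrow> ('a \<times> 'b \<times> 'c) set \<Rightarrow> bool" where
  "cylinder1 X\<^sub>1 X\<^sub>2 X\<^sub>3 S \<longleftrightarrow>
     S \<subseteq> X\<^sub>1 \<times> X\<^sub>2 \<times> X\<^sub>3 \<and> (\<forall>x y z. (x, y, z) \<in> S \<longrightarrow> (\<forall>x'\<in>X\<^sub>1. (x', y, z) \<in> S))"

definition cylinder2 :: "'a set \<Rightarrow> 'b set \<Rightarrow> 'c set \<Rightarrow> ('a \<times> 'b \<times> 'c) set \<Rightarrow> bool" where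
  "cylinder2 X\<^sub>1 X\<^sub>2 X\<^sub>3 S \<longleftrightarrow>
     S \<subseteq> X\<^sub>1 \<times> X\<^sub>2 \<times> X\<^sub>3 \<and> (\<forall>x y z. (x, y, z) \<in> S \<longrightarrow> (\<forall>y'\<in>X\<^sub>2. (x, y', z) \<in> S))"

definition cylinder3 :: "'a set \<Rightarrow> 'b set \<Rightarrow> 'c set \<Rightarrow> ('a \<times> 'b \<times> 'c) set \<Rightarrow> bool" where
  "cylinder3 X\<^sub>1 X\<^sub>2 X\<^sub>3 S \<longleftrightarrow>
     S \<subseteq> X\<^sub>1 \<times> X\<^sub>2 \<times> X\<^sub>3 \<and> (\<forall>x y z. (x, y, z) \<in> S \<longrightarrow> (\<forall>z'\<in>X\<^sub>3. (x, y, z') \<in> S))"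

definition cylinder_intersection ::
    "'a set \<Rightarrow> 'b set \<Rightarrow> 'c set \<Rightarrow> ('a \<times> 'b \<times> 'c) set \<Rightarrow> bool" where
  "cylinder_intersection X\<^sub>1 X\<^sub>2 X\<^sub>3 S \<longleftrightarrow>
     (\<exists>T\<^sub>1 T\<^sub>2 T\<^sub>3. cylinder1 X\<^sub>1 X\<^sub>2 X\<^sub>3 T\<^sub>1 \<and> cylinder2 X\<^sub>1 X\<^sub>2 X\<^sub>3 T\<^sub>2 \<and> cylinder3 X\<^sub>1 X\<^sub>2 X\<^sub>3 T\<^sub>3 \<and>
        S = T\<^sub>1 \<inter> T\<^sub>2 \<inter> T\<^sub>3)"

definition ones :: "'a set \<Rightarrow> 'b set \<Rightarrow> 'c set \<Rightarrow> ('a \<times> 'b \<times> 'c \<Rightarrow> nat) \<Rightarrow> ('a \<times> 'b \<times> 'c) set" where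
  "ones X\<^sub>1 X\<^sub>2 X\<^sub>3 f = {p \<in> X\<^sub>1 \<times> X\<^sub>2 \<times> X\<^sub>3. f p = 1}"

definition cylinder_cover :: "'a set \<Rightarrow> 'b set \<Rightarrow> 'c set \<Rightarrow> ('a \<times> 'b \<times> 'c \<Rightarrow> nat) \<Rightarrow>
    ('a \<times> 'b \<times> 'c) set set \<Rightarrow> bool" where
  "cylinder_cover X\<^sub>1 X\<^sub>2 X\<^sub>3 f F \<longleftrightarrow>
     (\<forall>S\<in>F. cylinder_intersection X\<^sub>1 X\<^sub>2 X\<^sub>3 S \<and> S \<subseteq> ones X\<^sub>1 X\<^sub>2 X\<^sub>3 f) \<and> \<Union>F = ones X\<^sub>1 X\<^sub>2 X\<^sub>3 f"

text \<open>\<open>LEAST\<close> is only meaningful when some finite cover exists; this holds for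
  finite \<open>X\<^sub>1\<close>, \<open>X\<^sub>2\<close>, \<open>X\<^sub>3\<close> by \<open>finite_cylinder_cover_exists\<close> below.\<close>

definition chi3 :: "'a set \<Rightarrow> 'b set \<Rightarrow> 'c set \<Rightarrow> ('a \<times> 'b \<times> 'c \<Rightarrow> nat) \<Rightarrow> nat" where
  "chi3 X\<^sub>1 X\<^sub>2 X\<^sub>3 f = (LEAST n. \<exists>F. finite F \<and> card F = n \<and> cylinder_cover X\<^sub>1 X\<^sub>2 X\<^sub>3 f F)"

lemma cylinder_intersection_singleton:
  assumes "p \<in> X\<^sub>1 \<times> X\<^sub>2 \<times> X\<^sub>3"
  shows "cylinder_intersection X\<^sub>1 X\<^sub>2 X\<^sub>3 {p}"
proof -
  obtain x y z where p: "p = (x, y, z)" "x \<in> X\<^sub>1" "y \<in> X\<^sub>2" "z \<in> X\<^sub>3"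
    using assms by auto
  have "cylinder1 X\<^sub>1 X\<^sub>2 X\<^sub>3 (X\<^sub>1 \<times> {y} \<times> {z})" "cylinder2 X\<^sub>1 X\<^sub>2 X\<^sub>3 ({x} \<times> X\<^sub>2 \<times> {z})"
    "cylinder3 X\<^sub>1 X\<^sub>2 X\<^sub>3 ({x} \<times> {y} \<times> X\<^sub>3)"
    using p by (auto simp: cylinder1_def cylinder2_def cylinder3_def)
  moreover have "{p} = (X\<^sub>1 \<times> {y} \<times> {z}) \<inter> ({x} \<times> X\<^sub>2 \<times> {z}) \<inter> ({x} \<times> {y} \<times> X\<^sub>3)"
    using p by auto
  ultimately show ?thesis
    unfolding cylinder_intersection_def by blast
qed

lemma finite_cylinder_cover_exists:
  assumes "finite X\<^sub>1" "finite X\<^sub>2" "finite X\<^sub>3"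
  shows "\<exists>F. finite F \<and> cylinder_cover X\<^sub>1 X\<^sub>2 X\<^sub>3 f F"
proof (intro exI conjI)
  let ?F = "(\<lambda>p. {p}) ` ones X\<^sub>1 X\<^sub>2 X\<^sub>3 f"
  show "finite ?F"
    using assms by (simp add: ones_def)
  show "cylinder_cover X\<^sub>1 X\<^sub>2 X\<^sub>3 f ?F"
    by (auto simp: cylinder_cover_def ones_def intro: cylinder_intersection_singleton)
qed

lemma finite_Z2_pow: "finite (Z2_pow m)"
proof (rule finite_subset)
  let ?g = "\<lambda>A i. if i \<in> A then 1 else (0 :: bit)"
  show "Z2_pow m \<subseteq> ?g ` Pow {..<m}"
  proof
    fix x assume x: "x \<in> Z2_pow m"
    have "{i. x i = 1} \<subseteq> {..<m}"
      using x by (force simp: Z2_pow_def not_le[symmetric])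
    moreover have "x = ?g {i. x i = 1}"
      by auto
    ultimately show "x \<in> ?g ` Pow {..<m}" by blast
  qed
qed simp

end

(* Colour the pair (x, y) by the vector (x_{2k} + y_{2k+1})_k, which has about m/2 entries.
   Shifting x by d changes this colour by the even coordinates of d, and shifting y by d changes
   it by the odd ones, so (x, y), (x + d, y) and (x, y + d) get the same colour only if d = 0.
   Hence no colour class contains a nontrivial corner, which makes each class, lifted to the plane
   x + y + z = T, a cylinder intersection. There are at most 2^((m+1)/2) colours. *)
theory Submission
  imports Defs
begin

lemma chi3_le_card:
  assumes "finite F" "cylinder_cover X Y Z f F"
  shows "chi3 X Y Z f \<le> card F"
  unfolding chi3_def using assms by (intro Least_le) blast

text \<open>The class is cut out by three colour conditions, each blind to one coordinate; together
  they force \<open>x + y + z = T\<close> because a monochromatic corner is trivial. Corner-freeness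
  is assumed on the whole type, since \<open>T - y - z\<close> may lie outside \<open>X\<close> and
  \<open>T - x - z\<close> outside \<open>Y\<close>.\<close>

lemma cylinder_intersection_colour_class:
  fixes X Y Z :: "'a :: ab_group_add set" and \<kappa> :: "'a \<Rightarrow> 'a \<Rightarrow> 'c"
  assumes corner_free: "\<And>x y d. \<kappa> (x + d) y = \<kappa> x y \<Longrightarrow> \<kappa> x (y + d) = \<kappa> x y \<Longrightarrow> d = 0"
  shows "cylinder_intersection X Y Z {(x, y, z) \<in> X \<times> Y \<times> Z. x + y + z = T \<and> \<kappa> x y = c}"
proof -
  \<comment> \<open>Solving the plane equation for \<open>x\<close> gives a condition free of
    \<open>x\<close>, hence a cylinder in dimension 1; likewise for \<open>y\<close> in
    \<open>?T2\<close>.\<close>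
  let ?T1 = "{(x, y, z) \<in> X \<times> Y \<times> Z. \<kappa> (T - y - z) y = c}"
  let ?T2 = "{(x, y, z) \<in> X \<times> Y \<times> Z. \<kappa> x (T - x - z) = c}"
  let ?T3 = "{(x, y, z) \<in> X \<times> Y \<times> Z. \<kappa> x y = c}"
  have plane: "x + y + z = T"
    if "\<kappa> (T - y - z) y = c" "\<kappa> x (T - x - z) = c" "\<kappa> x y = c" for x y z
  proof -
    \<comment> \<open>\<open>?d\<close> is the defect of \<open>(x, y, z)\<close> from the plane.
      The three conditions say that the corner at \<open>(x, y)\<close> with side \<open>?d\<close>
      is monochromatic.\<close>
    let ?d = "T - x - y - z"
    have "x + ?d = T - y - z" "y + ?d = T - x - z"
      by (simp_all add: algebra_simps)
    then have "\<kappa> (x + ?d) y = \<kappa> x y" "\<kappa> x (y + ?d) = \<kappa> x y"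
      using that by (simp_all only:)
    then have "?d = 0"
      by (rule corner_free)
    then show ?thesis
      by (simp add: diff_eq_eq add_ac)
  qed
  have solve: "T - y - z = x" "T - x - z = y" if "x + y + z = T" for x y z
    unfolding that[symmetric] by simp_all
  have "x + y + z = T \<and> \<kappa> x y = c \<longleftrightarrow>
      \<kappa> (T - y - z) y = c \<and> \<kappa> x (T - x - z) = c \<and> \<kappa> x y = c" for x y z
    using plane solve by metis
  then have "{(x, y, z) \<in> X \<times> Y \<times> Z. x + y + z = T \<and> \<kappa> x y = c} = ?T1 \<inter> ?T2 \<inter> ?T3"
    by blast
  moreover have "cylinder1 X Y Z ?T1" "cylinder2 X Y Z ?T2" "cylinder3 X Y Z ?T3"
    by (auto simp: cylinder1_def cylinder2_def cylinder3_def)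
  ultimately show ?thesis
    unfolding cylinder_intersection_def by blast
qed

text \<open>Every point of the plane over \<open>X\<close>, \<open>Y\<close>, \<open>Z\<close> has a
  colour in \<open>K\<close>, so the colour classes indexed by \<open>K\<close> form a
  cover.\<close>

lemma chi3_le_colours:
  fixes X Y Z :: "'a :: ab_group_add set" and \<kappa> :: "'a \<Rightarrow> 'a \<Rightarrow> 'c"
  assumes "\<And>x y d. \<kappa> (x + d) y = \<kappa> x y \<Longrightarrow> \<kappa> x (y + d) = \<kappa> x y \<Longrightarrow> d = 0"
    and "finite K" and colours: "\<And>x y. x \<in> X \<Longrightarrow> y \<in> Y \<Longrightarrow> \<kappa> x y \<in> K"
    and ones: "ones X Y Z f = {(x, y, z) \<in> X \<times> Y \<times> Z. x + y + z = T}"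
  shows "chi3 X Y Z f \<le> card K"
proof -
  define S where "S c = {(x, y, z) \<in> X \<times> Y \<times> Z. x + y + z = T \<and> \<kappa> x y = c}" for c
  have "cylinder_intersection X Y Z (S c)" for c
    unfolding S_def by (rule cylinder_intersection_colour_class) (fact assms(1))
  moreover have "S c \<subseteq> ones X Y Z f" for c
    by (auto simp: S_def ones)
  moreover have "(\<Union>c\<in>K. S c) = ones X Y Z f"
    using colours by (auto simp: S_def ones)
  ultimately have "cylinder_cover X Y Z f (S ` K)"
    by (auto simp: cylinder_cover_def)
  then have "chi3 X Y Z f \<le> card (S ` K)"
    using \<open>finite K\<close> by (intro chi3_le_card) auto
  \<comment> \<open>Only an inequality: distinct colours can both have the empty class.\<close>
  also have "\<dots> \<le> card K"
    using \<open>finite K\<close> by (rule card_image_le)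
  finally show ?thesis .
qed

lemma card_Z2_pow_le: "card (Z2_pow n) \<le> 2 ^ n"
proof -
  have "inj_on (\<lambda>x. {i. x i = 1}) (Z2_pow n)"
  proof (intro inj_onI ext)
    fix x y :: "nat \<Rightarrow> bit" and i
    assume "{i. x i = 1} = {i. y i = 1}"
    then have "x i = 1 \<longleftrightarrow> y i = 1" by blast
    then show "x i = y i" by (cases "x i"; cases "y i") simp_all
  qed
  moreover have "(\<lambda>x. {i. x i = 1}) ` Z2_pow n \<subseteq> Pow {..<n}"
    by (force simp: Z2_pow_def not_le[symmetric])
  ultimately have "card (Z2_pow n) \<le> card (Pow {..<n})"
    by (intro card_inj_on_le) auto
  then show ?thesis
    by (simp add: card_Pow)
qed

definition interleaved_sum :: "(nat \<Rightarrow> 'a) \<Rightarrow> (nat \<Rightarrow> 'a) \<Rightarrow> nat \<Rightarrow> 'a :: ab_group_add" where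
  "interleaved_sum x y k = x (2 * k) + y (2 * k + 1)"

lemma interleaved_sum_corner_free:
  assumes "interleaved_sum (x + d) y = interleaved_sum x y"
    and "interleaved_sum x (y + d) = interleaved_sum x y"
  shows "d = 0"
proof
  fix i
  have "d (2 * k) = 0" for k
    using fun_cong[OF assms(1), of k] by (simp add: interleaved_sum_def algebra_simps)
  moreover have "d (2 * k + 1) = 0" for k
    using fun_cong[OF assms(2), of k] by (simp add: interleaved_sum_def algebra_simps)
  ultimately show "d i = 0 i"
    by (cases "even i") (auto elim!: evenE oddE)
qed

text \<open>For \<open>k \<ge> (m + 1) div 2\<close> both \<open>2 * k\<close> and
  \<open>2 * k + 1\<close> are at least \<open>m\<close>. Rounding up matters for odd
  \<open>m\<close>, where the last coordinate \<open>m - 1\<close> is even and contributes the entry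
  \<open>(m - 1) div 2\<close>.\<close>

lemma interleaved_sum_in_Z2_pow:
  assumes "x \<in> Z2_pow m" "y \<in> Z2_pow m"
  shows "interleaved_sum x y \<in> Z2_pow ((m + 1) div 2)"
  using assms by (auto simp: Z2_pow_def interleaved_sum_def)

theorem corollary28:
  shows "\<exists>C::real. \<forall>m::nat. m \<ge> 1 \<longrightarrow>
    (\<forall>T \<in> Z2_pow m. \<forall>f :: (nat \<Rightarrow> bit) \<times> (nat \<Rightarrow> bit) \<times> (nat \<Rightarrow> bit) \<Rightarrow> nat.
      (\<forall>x \<in> Z2_pow m. \<forall>y \<in> Z2_pow m. \<forall>z \<in> Z2_pow m.
         f (x, y, z) \<in> {0, 1} \<and> (f (x, y, z) = 1 \<longleftrightarrow> x + y + z = T)) \<longrightarrow>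
      real (chi3 (Z2_pow m) (Z2_pow m) (Z2_pow m) f) \<le> C * real m * 2 powr (real m / 2))"
\<comment> \<open>The constant pays for the rounding: \<open>(m + 1) div 2\<close> exceeds
  \<open>m / 2\<close> by at most \<open>1 / 2\<close>.\<close>
proof (intro exI[of _ "sqrt 2"] allI impI ballI)
  fix m :: nat and T :: "nat \<Rightarrow> bit" and f :: "(nat \<Rightarrow> bit) \<times> (nat \<Rightarrow> bit) \<times> (nat \<Rightarrow> bit) \<Rightarrow> nat"
  assume m: "m \<ge> 1"
    and f: "\<forall>x \<in> Z2_pow m. \<forall>y \<in> Z2_pow m. \<forall>z \<in> Z2_pow m.
      f (x, y, z) \<in> {0, 1} \<and> (f (x, y, z) = 1 \<longleftrightarrow> x + y + z = T)"
  let ?X = "Z2_pow m" and ?n = "(m + 1) div 2"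
  have "ones ?X ?X ?X f = {(x, y, z) \<in> ?X \<times> ?X \<times> ?X. x + y + z = T}"
    using f by (auto simp: ones_def)
  then have "chi3 ?X ?X ?X f \<le> card (Z2_pow ?n)"
    \<comment> \<open>The rotation puts the premise on \<open>ones\<close> first, to match the
      chained fact.\<close>
    by (rule chi3_le_colours[where \<kappa> = interleaved_sum, rotated 3])
      (fact interleaved_sum_corner_free finite_Z2_pow interleaved_sum_in_Z2_pow)+
  also have "\<dots> \<le> 2 ^ ?n"
    by (rule card_Z2_pow_le)
  finally have "real (chi3 ?X ?X ?X f) \<le> real (2 ^ ?n)"
    by (rule of_nat_mono)
  also have "\<dots> = 2 powr real ?n"
    by (simp add: powr_realpow)
  also have "\<dots> \<le> 2 powr (1 / 2 + real m / 2)"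
  proof (rule powr_mono)
    have "2 * ?n \<le> m + 1" by simp
    then have "real (2 * ?n) \<le> real (m + 1)" by (rule of_nat_mono)
    then show "real ?n \<le> 1 / 2 + real m / 2" by simp
  qed simp
  also have "\<dots> = sqrt 2 * 2 powr (real m / 2)"
    by (simp add: powr_add powr_half_sqrt)
  also have "\<dots> \<le> sqrt 2 * real m * 2 powr (real m / 2)"
    using m by simp
  finally show "real (chi3 ?X ?X ?X f) \<le> sqrt 2 * real m * 2 powr (real m / 2)" .
qed

end
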